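(* Let $k\geq 1$. The image $c^{k}(\beta(A^* ))$ of the continuous map $c^k:\beta(A^* )\to V_k$ is equal to $X_k$, i.e. to the set of all $\overrightarrow{C}=(C_{\bar a})_{\bar a\in A^k}\in V_k$ for which there exists an ultrafilter $u$ of the Boolean algebra $\mathcal B_k$ such that, for every $\bar a\in A^k$ and every $Q\subseteq \mathbb N^k$, $C_{\bar a}\cap\widehat{Q}\neq\emptyset$ if and only if $L_{\Diamond^{\bar a}_Q}\in u$.
   Context: $A$ is a finite alphabet, $A^*$ the free monoid of finite words; a word $w$ has positions $0,\dots,|w|-1$ and $w_i$ is its letter at position $i$. For $k\geq1$ and $w\in A^*$, $|w|^k:=\{\bar i=(i_1,\dots,i_k)\in\mathbb N^k: i_j<|w| \text{ for all } j\}$; for $\bar a=(a_1,\dots,a_k)\in A^k$ write $w[\bar i]=\bar a$ if $w_{i_j}=a_j$ for all $j$. The $\bar a$-content of $w$ is $c_{\bar a}(w):=\{\bar i\in|w|^k: w[\bar i]=\bar a\}$ (a finite subset of $\mathbb N^k$). For $Q\subseteq\mathbb N^k$ let $L_{\Diamond^{\bar a}_Q}:=\{w\in A^*: c_{\bar a}(w)\cap Q\neq\emptyset\}$. $\mathcal B_k$ is the Boolean subalgebra of $\mathcal P(A^* )$ generated by all $L_{\Diamond^{\bar a}_Q}$ ($\bar a\in A^k$, $Q\subseteq\mathbb N^k$). For a set $S$, $\beta(S)$ is the space of ultrafilters on $S$ (Čech–Stone compactification of discrete $S$, with $s\in S$ identified with the principal ultrafilter at $s$), with basic clopens $\widehat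 Q:=\{\alpha\in\beta(S): Q\in\alpha\}$. For a Boolean space $X$, $\mathcal V(X)$ is the set of closed subsets of $X$ with the Vietoris topology, generated by $\Box K=\{C: C\subseteq K\}$ and $\Diamond K=\{C: C\cap K\neq\emptyset\}$ for $K$ clopen. $V_k:=\mathcal V(\beta(\mathbb N^k))^{A^k}$ with the product topology. The map $w\mapsto(\widehat{c_{\bar a}(w)})_{\bar a\in A^k}$ from $A^*$ to $V_k$ extends uniquely to a continuous map $c^k:\beta(A^* )\to V_k$. The set $X_k$ described in the claim is the standard identification of the Stone dual space of $\mathcal B_k$ with a subspace of $V_k$. *)

theory Defs
  imports "HOL-Analysis.Analysis"
begin

definition tuples :: "'s set \<Rightarrow> nat \<Rightarrow> 's list set" where
  "tuples S k = {xs. set xs \<subseteq> S \<and> length xs = k}"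

abbreviation nat_tuples :: "nat \<Rightarrow> nat list set" where
  "nat_tuples k \<equiv> tuples UNIV k"

text \<open>The content of a word \<open>w\<close> with respect to a tuple \<open>a\<close> of letters, with \<open>k\<close> read off
  as the length of \<open>a\<close>.\<close>

definition content :: "'a list \<Rightarrow> 'a list \<Rightarrow> nat list set" where
  "content a w = {i \<in> nat_tuples (length a).
     (\<forall>j<length a. i ! j < length w) \<and> (\<forall>j<length a. w ! (i ! j) = a ! j)}"

definition L_diamond :: "'a set \<Rightarrow> 'a list \<Rightarrow> nat list set \<Rightarrow> 'a list set" where
  "L_diamond A a Q = {w \<in> lists A. content a w \<inter> Q \<noteq> {}}"

text \<open>\<^const>\<open>algebra\<close> is the library's predicate for Boolean subalgebras of a powerset;
  the hull is the least one containing the given family.\<close>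

definition B_alg :: "'a set \<Rightarrow> nat \<Rightarrow> 'a list set set" where
  "B_alg A k = algebra (lists A) hull {L_diamond A a Q |a Q. a \<in> tuples A k \<and> Q \<subseteq> nat_tuples k}"

text \<open>Ultrafilters of a Boolean subalgebra \<open>B\<close> of the powerset of \<open>S\<close>.\<close>

definition ultrafilters :: "'s set \<Rightarrow> 's set set \<Rightarrow> 's set set set" where
  "ultrafilters S B = {u. u \<subseteq> B \<and> S \<in> u \<and> {} \<notin> u \<and>
     (\<forall>L\<in>u. \<forall>M\<in>u. L \<inter> M \<in> u) \<and>
     (\<forall>L\<in>u. \<forall>M\<in>B. L \<subseteq> M \<longrightarrow> M \<in> u) \<and>
     (\<forall>L\<in>B. L \<in> u \<or> S - L \<in> u)}"

definition hat :: "'s set \<Rightarrow> 's set \<Rightarrow> 's set set set" where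
  "hat S Q = {\<alpha> \<in> ultrafilters S (Pow S). Q \<in> \<alpha>}"

definition beta :: "'s set \<Rightarrow> 's set set topology" where
  "beta S = topology_generated_by {hat S Q |Q. Q \<subseteq> S}"

definition principal :: "'s set \<Rightarrow> 's \<Rightarrow> 's set set" where
  "principal S s = {Q. Q \<subseteq> S \<and> s \<in> Q}"

definition clopenin :: "'x topology \<Rightarrow> 'x set \<Rightarrow> bool" where
  "clopenin X K \<longleftrightarrow> closedin X K \<and> openin X K"

definition vietoris_box :: "'x topology \<Rightarrow> 'x set \<Rightarrow> 'x set set" where
  "vietoris_box X K = {C. closedin X C \<and> C \<subseteq> K}"

definition vietoris_diamond :: "'x topology \<Rightarrow> 'x set \<Rightarrow> 'x set set" where
  "vietoris_diamond X K = {C. closedin X C \<and> C \<inter> K \<noteq> {}}"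

text \<open>The underlying set consists of all closed subsets, the empty one included, since it equals
  \<open>vietoris_box X (topspace X)\<close>.\<close>

definition vietoris :: "'x topology \<Rightarrow> 'x set topology" where
  "vietoris X = topology_generated_by
     ({vietoris_box X K |K. clopenin X K} \<union> {vietoris_diamond X K |K. clopenin X K})"

definition V_space :: "'a set \<Rightarrow> nat \<Rightarrow> ('a list \<Rightarrow> nat list set set set) topology" where
  "V_space A k = product_topology (\<lambda>a. vietoris (beta (nat_tuples k))) (tuples A k)"

definition word_contents :: "'a set \<Rightarrow> nat \<Rightarrow> 'a list \<Rightarrow> 'a list \<Rightarrow> nat list set set set" where
  "word_contents A k w = (\<lambda>a\<in>tuples A k. hat (nat_tuples k) (content a w))"

text \<open>The unique continuous extension of \<^const>\<open>word_contents\<close> along the embedding of words as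
  principal ultrafilters. Extensionality only fixes the irrelevant values outside the space of
  ultrafilters, as uniqueness of a total function requires.\<close>

definition content_map ::
  "'a set \<Rightarrow> nat \<Rightarrow> 'a list set set \<Rightarrow> 'a list \<Rightarrow> nat list set set set" where
  "content_map A k = (THE c. c \<in> extensional (topspace (beta (lists A))) \<and>
     continuous_map (beta (lists A)) (V_space A k) c \<and>
     (\<forall>w\<in>lists A. c (principal (lists A) w) = word_contents A k w))"

definition X_space :: "'a set \<Rightarrow> nat \<Rightarrow> ('a list \<Rightarrow> nat list set set set) set" where
  "X_space A k = {C \<in> topspace (V_space A k).
     \<exists>u \<in> ultrafilters (lists A) (B_alg A k).
       \<forall>a\<in>tuples A k. \<forall>Q. Q \<subseteq> nat_tuples k \<longrightarrow>
         (C a \<inter> hat (nat_tuples k) Q \<noteq> {} \<longleftrightarrow> L_diamond A a Q \<in> u)}"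

end

theory Submission
  imports Defs
begin

text \<open>For an ultrafilter \<open>x\<close> of languages, the ultrafilters \<open>\<alpha>\<close> on \<open>\<nat>\<^sup>k\<close> all of whose members \<open>Q\<close>
  satisfy \<open>L_diamond A a Q \<in> x\<close> form a closed set. Since \<open>Q \<mapsto> L_diamond A a Q\<close> preserves finite
  unions, the prime ideal theorem shows that this closed set meets \<open>hat Q\<close> exactly when
  \<open>L_diamond A a Q \<in> x\<close>. Every clopen of \<open>\<beta>(S)\<close> is some \<open>hat Q\<close>, because the principal ultrafilters
  are dense; so these closed sets depend continuously on \<open>x\<close>, and they give the content map. The
  theorem then amounts to the fact that the ultrafilters of a subalgebra are exactly the traces of
  the ultrafilters of the full powerset.\<close>

section \<open>Ultrafilters\<close>

text \<open>Maximality criterion. A superset of a member meets every member, so \<open>meets\<close>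
  yields upward closure. If \<open>S - L\<close> is not in \<open>F\<close>, then no member lies
  inside \<open>S - L\<close>, so every member meets \<open>L\<close>, which gives the
  dichotomy.\<close>

lemma ultrafilter_PowI:
  assumes "F \<subseteq> Pow S" "F \<noteq> {}" "{} \<notin> F"
    and "\<And>P Q. P \<in> F \<Longrightarrow> Q \<in> F \<Longrightarrow> P \<inter> Q \<in> F"
    and meets: "\<And>L. L \<subseteq> S \<Longrightarrow> (\<And>P. P \<in> F \<Longrightarrow> P \<inter> L \<noteq> {}) \<Longrightarrow> L \<in> F"
  shows "F \<in> ultrafilters S (Pow S)"
proof -
  have up: "M \<in> F" if "L \<in> F" "L \<subseteq> M" "M \<in> Pow S" for L M
  proof (rule meets)
    show "M \<subseteq> S" using that(3) by simp
    fix P assume "P \<in> F"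
    then have "P \<inter> L \<noteq> {}" using assms(3,4) that(1) by metis
    then show "P \<inter> M \<noteq> {}" using that(2) by blast
  qed
  have "L \<in> F \<or> S - L \<in> F" if "L \<subseteq> S" for L
  proof (rule disjCI)
    assume "S - L \<notin> F"
    then have "\<And>P. P \<in> F \<Longrightarrow> \<not> P \<subseteq> S - L" using up by blast
    then show "L \<in> F" using meets[OF that] assms(1) by blast
  qed
  moreover have "S \<in> F" using up assms(1,2) by blast
  ultimately show ?thesis
    using assms(1,3) assms(4) up unfolding ultrafilters_def mem_Collect_eq
    by (intro conjI ballI impI) auto
qed

lemma ultrafilter_extension:
  assumes F: "F \<subseteq> Pow S" "F \<noteq> {}" "{} \<notin> F"
    and F_Int: "\<And>P Q. P \<in> F \<Longrightarrow> Q \<in> F \<Longrightarrow> P \<inter> Q \<in> F"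
  obtains \<alpha> where "\<alpha> \<in> ultrafilters S (Pow S)" "F \<subseteq> \<alpha>"
proof -
  \<comment> \<open>Members of \<open>Z\<close> are closed under intersection but not necessarily
    upwards, which keeps the union of a chain easy to handle. Upward closure of a maximal element
    comes from \<open>ultrafilter_PowI\<close>.\<close>
  define Z where "Z = {G. F \<subseteq> G \<and> G \<subseteq> Pow S \<and> {} \<notin> G \<and> (\<forall>P\<in>G. \<forall>Q\<in>G. P \<inter> Q \<in> G)}"
  have "\<Union>C \<in> Z" if C: "C \<in> chains Z" "C \<noteq> {}" for C
  proof -
    have "P \<inter> Q \<in> \<Union>C" if "P \<in> \<Union>C" "Q \<in> \<Union>C" for P Q
    proof -
      from that obtain G H where GH: "P \<in> G" "G \<in> C" "Q \<in> H" "H \<in> C" by blast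
      then have "G \<subseteq> H \<or> H \<subseteq> G" using C(1) unfolding chains_def chain_subset_def by blast
      then obtain K where K: "K \<in> C" "P \<in> K" "Q \<in> K" using GH by blast
      then have "K \<in> Z" using C(1) unfolding chains_def by auto
      then have "P \<inter> Q \<in> K" using K(2,3) unfolding Z_def by simp
      then show ?thesis using K(1) by blast
    qed
    moreover have CZ: "G \<in> Z" if "G \<in> C" for G using C(1) that unfolding chains_def by auto
    moreover have "\<Union>C \<subseteq> Pow S" "{} \<notin> \<Union>C" using CZ unfolding Z_def by simp_all blast+
    moreover obtain G where "G \<in> C" using C(2) by blast
    then have "F \<subseteq> \<Union>C" using CZ[of G] unfolding Z_def by auto
    ultimately show ?thesis
      unfolding Z_def mem_Collect_eq by (intro conjI ballI)
  qed
  moreover have "F \<in> Z" using F F_Int by (auto simp: Z_def)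
  ultimately have "\<forall>C\<in>chains Z. \<exists>U\<in>Z. \<forall>X\<in>C. X \<subseteq> U"
    by (metis Union_upper empty_iff)
  from Zorn_Lemma2[OF this] obtain M where M: "M \<in> Z" "\<And>X. X \<in> Z \<Longrightarrow> M \<subseteq> X \<Longrightarrow> X = M" by blast
  have M': "F \<subseteq> M" "M \<subseteq> Pow S" "{} \<notin> M" "\<And>P Q. P \<in> M \<Longrightarrow> Q \<in> M \<Longrightarrow> P \<inter> Q \<in> M"
    using M(1) unfolding Z_def by auto
  have "L \<in> M" if L: "L \<subseteq> S" "\<And>P. P \<in> M \<Longrightarrow> P \<inter> L \<noteq> {}" for L
  proof -
    \<comment> \<open>The filter generated by \<open>M\<close> and \<open>L\<close>. It omits the
      empty set because \<open>L\<close> meets every member of \<open>M\<close>, so maximality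
      forces \<open>G = M\<close>.\<close>
    define G where "G = {R. R \<subseteq> S \<and> (\<exists>P\<in>M. P \<inter> L \<subseteq> R)}"
    have sub: "M \<subseteq> G" using M'(2) by (auto simp: G_def)
    have "P \<inter> Q \<in> G" if PQ: "P \<in> G" "Q \<in> G" for P Q
    proof -
      obtain P' Q' where "P' \<in> M" "Q' \<in> M" "P' \<inter> L \<subseteq> P" "Q' \<inter> L \<subseteq> Q" "P \<subseteq> S"
        using PQ unfolding G_def by blast
      then have "P' \<inter> Q' \<in> M" "P' \<inter> Q' \<inter> L \<subseteq> P \<inter> Q" "P \<inter> Q \<subseteq> S"
        using M'(4) by auto
      then show ?thesis unfolding G_def by blast
    qed
    moreover have "{} \<notin> G" "G \<subseteq> Pow S" using L(2) unfolding G_def by blast+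
    ultimately have "G \<in> Z" using sub M'(1) unfolding Z_def by blast
    then have "G = M" using M(2) sub by blast
    moreover have "L \<in> G" using L(1) M'(1) F(2) unfolding G_def by blast
    ultimately show ?thesis by simp
  qed
  then have "M \<in> ultrafilters S (Pow S)"
    using M' F(2) by (intro ultrafilter_PowI) auto
  then show ?thesis using that M'(1) by blast
qed

lemma ultrafilterD:
  assumes "u \<in> ultrafilters S B"
  shows "u \<subseteq> B" "S \<in> u" "{} \<notin> u"
    and "\<And>L M. L \<in> u \<Longrightarrow> M \<in> u \<Longrightarrow> L \<inter> M \<in> u"
    and "\<And>L M. L \<in> u \<Longrightarrow> L \<subseteq> M \<Longrightarrow> M \<in> B \<Longrightarrow> M \<in> u"
    and "\<And>L. L \<in> B \<Longrightarrow> L \<in> u \<or> S - L \<in> u"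
  using assms unfolding ultrafilters_def by auto

lemma ultrafilter_Diff_iff:
  assumes "u \<in> ultrafilters S B" "L \<in> B"
  shows "S - L \<in> u \<longleftrightarrow> L \<notin> u"
proof -
  have "False" if "S - L \<in> u" "L \<in> u"
    using ultrafilterD(3,4)[OF assms(1)] that by (metis Diff_disjoint inf_commute)
  then show ?thesis using ultrafilterD(6)[OF assms] by blast
qed

lemma ultrafilter_Un_iff:
  assumes "x \<in> ultrafilters S (Pow S)" "L \<subseteq> S" "M \<subseteq> S"
  shows "L \<union> M \<in> x \<longleftrightarrow> L \<in> x \<or> M \<in> x"
proof
  assume "L \<union> M \<in> x"
  show "L \<in> x \<or> M \<in> x"
  proof (rule ccontr)
    assume "\<not> (L \<in> x \<or> M \<in> x)"
    then have "S - L \<in> x" "S - M \<in> x" using assms ultrafilterD(6)[OF assms(1)] by blast+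
    then have "(L \<union> M) \<inter> ((S - L) \<inter> (S - M)) \<in> x"
      using \<open>L \<union> M \<in> x\<close> by (intro ultrafilterD(4)[OF assms(1)])
    moreover have "(L \<union> M) \<inter> ((S - L) \<inter> (S - M)) = {}" by blast
    ultimately show False using ultrafilterD(3)[OF assms(1)] by metis
  qed
next
  assume "L \<in> x \<or> M \<in> x"
  then show "L \<union> M \<in> x" using ultrafilterD(5)[OF assms(1)] assms(2,3) by blast
qed

lemma principal_ultrafilter: "s \<in> S \<Longrightarrow> principal S s \<in> ultrafilters S (Pow S)"
  unfolding principal_def ultrafilters_def by auto

lemma ultrafilter_restrict:
  assumes "x \<in> ultrafilters S (Pow S)" "algebra S B"
  shows "x \<inter> B \<in> ultrafilters S B"
proof -
  interpret algebra S B by fact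
  note x = ultrafilterD[OF assms(1)]
  show ?thesis
    unfolding ultrafilters_def mem_Collect_eq
  proof (intro conjI ballI impI)
    show "L \<inter> M \<in> x \<inter> B" if "L \<in> x \<inter> B" "M \<in> x \<inter> B" for L M using that x(4) by auto
    show "M \<in> x \<inter> B" if "L \<in> x \<inter> B" "M \<in> B" "L \<subseteq> M" for L M
      using that x(5)[of L M] sets_into_space[of M] by auto
    show "L \<in> x \<inter> B \<or> S - L \<in> x \<inter> B" if "L \<in> B" for L
      using that x(6)[of L] sets_into_space[of L] compl_sets by auto
  qed (use x(2,3) in auto)
qed

text \<open>\<open>u\<close> generates a proper filter in the full powerset, so some ultrafilter
  \<open>x\<close> contains it. The trace of \<open>x\<close> cannot exceed \<open>u\<close>: for an
  \<open>L\<close> in \<open>B\<close> missing from \<open>u\<close>, the complement is in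
  \<open>u\<close> and hence in \<open>x\<close>.\<close>

lemma ultrafilter_subalgebra_extension:
  assumes u: "u \<in> ultrafilters S B" and B: "B \<subseteq> Pow S"
  obtains x where "x \<in> ultrafilters S (Pow S)" "x \<inter> B = u"
proof -
  obtain x where x: "x \<in> ultrafilters S (Pow S)" "u \<subseteq> x"
    using ultrafilter_extension[of u S] ultrafilterD[OF u] B by blast
  have "x \<inter> B \<subseteq> u"
    using ultrafilterD(6)[OF u] ultrafilter_Diff_iff[OF x(1)] x(2) B by blast
  then show ?thesis using that x ultrafilterD(1)[OF u] by blast
qed

section \<open>The space of ultrafilters\<close>

lemma hat_iff: "\<alpha> \<in> hat S Q \<longleftrightarrow> \<alpha> \<in> ultrafilters S (Pow S) \<and> Q \<in> \<alpha>"
  unfolding hat_def by simp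

text \<open>The base property of the sets \<open>hat S Q\<close>, stated at a point: membership of
  \<open>\<alpha>\<close> already forces \<open>P\<close> and \<open>Q\<close> to be subsets of
  \<open>S\<close>.\<close>

lemma hat_Int_subset:
  assumes "\<alpha> \<in> hat S P" "\<alpha> \<in> hat S Q"
  shows "\<alpha> \<in> hat S (P \<inter> Q)" "hat S (P \<inter> Q) \<subseteq> hat S P \<inter> hat S Q"
proof -
  have *: "\<alpha> \<in> ultrafilters S (Pow S)" "P \<in> \<alpha>" "Q \<in> \<alpha>" using assms by (auto simp: hat_iff)
  then have "P \<subseteq> S" "Q \<subseteq> S" using ultrafilterD(1) by blast+
  then show "hat S (P \<inter> Q) \<subseteq> hat S P \<inter> hat S Q"
    using ultrafilterD(5)[where B = "Pow S"] by (auto simp: hat_iff)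
  show "\<alpha> \<in> hat S (P \<inter> Q)" using * ultrafilterD(4)[OF *(1)] by (auto simp: hat_iff)
qed

lemma hat_compl:
  "Q \<subseteq> S \<Longrightarrow> hat S (S - Q) = ultrafilters S (Pow S) - hat S Q"
  using ultrafilter_Diff_iff[of _ S "Pow S" Q] by (auto simp: hat_iff)

lemma topspace_beta: "topspace (beta S) = ultrafilters S (Pow S)"
proof
  show "topspace (beta S) \<subseteq> ultrafilters S (Pow S)"
    unfolding beta_def topology_generated_by_topspace hat_def by blast
  have "ultrafilters S (Pow S) \<subseteq> hat S S" by (auto simp: hat_iff dest: ultrafilterD(2))
  then show "ultrafilters S (Pow S) \<subseteq> topspace (beta S)"
    unfolding beta_def topology_generated_by_topspace by blast
qed

lemma openin_beta_hat: "Q \<subseteq> S \<Longrightarrow> openin (beta S) (hat S Q)"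
  unfolding beta_def by (rule topology_generated_by_Basis) auto

text \<open>The hats are given as a subbase. Induction over the generation of open sets shows that
  they form a base, the intersection case being \<open>hat_Int_subset\<close>.\<close>

lemma openin_beta_iff:
  "openin (beta S) U \<longleftrightarrow>
    U \<subseteq> ultrafilters S (Pow S) \<and> (\<forall>\<alpha>\<in>U. \<exists>Q\<subseteq>S. \<alpha> \<in> hat S Q \<and> hat S Q \<subseteq> U)"
proof
  assume "openin (beta S) U"
  then have "generate_topology_on {hat S Q |Q. Q \<subseteq> S} U"
    unfolding beta_def openin_topology_generated_by_iff .
  then have "\<forall>\<alpha>\<in>U. \<exists>Q\<subseteq>S. \<alpha> \<in> hat S Q \<and> hat S Q \<subseteq> U"
  proof induction
    case (Int a b)
    show ?case
    proof
      fix \<alpha> assume "\<alpha> \<in> a \<inter> b"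
      then obtain P Q where "P \<subseteq> S" "\<alpha> \<in> hat S P" "hat S P \<subseteq> a" "\<alpha> \<in> hat S Q" "hat S Q \<subseteq> b"
        using Int.IH by (metis IntD1 IntD2)
      then show "\<exists>R\<subseteq>S. \<alpha> \<in> hat S R \<and> hat S R \<subseteq> a \<inter> b"
        using hat_Int_subset[of \<alpha> S P Q] by (intro exI[of _ "P \<inter> Q"]) blast
    qed
  next
    case (UN K)
    show ?case
    proof
      fix \<alpha> assume "\<alpha> \<in> \<Union>K"
      then obtain V where V: "V \<in> K" "\<alpha> \<in> V" by blast
      then obtain Q where "Q \<subseteq> S" "\<alpha> \<in> hat S Q" "hat S Q \<subseteq> V" using UN.IH by metis
      then show "\<exists>Q\<subseteq>S. \<alpha> \<in> hat S Q \<and> hat S Q \<subseteq> \<Union>K" using V(1) by blast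
    qed
  qed auto
  moreover have "U \<subseteq> ultrafilters S (Pow S)"
    using openin_subset[OF \<open>openin (beta S) U\<close>] topspace_beta by blast
  ultimately show "U \<subseteq> ultrafilters S (Pow S) \<and> (\<forall>\<alpha>\<in>U. \<exists>Q\<subseteq>S. \<alpha> \<in> hat S Q \<and> hat S Q \<subseteq> U)" by blast
next
  assume "U \<subseteq> ultrafilters S (Pow S) \<and> (\<forall>\<alpha>\<in>U. \<exists>Q\<subseteq>S. \<alpha> \<in> hat S Q \<and> hat S Q \<subseteq> U)"
  then show "openin (beta S) U"
    using openin_beta_hat by (subst openin_subopen) blast
qed

lemma clopenin_hat: "Q \<subseteq> S \<Longrightarrow> clopenin (beta S) (hat S Q)"
proof -
  assume Q: "Q \<subseteq> S"
  have "openin (beta S) (topspace (beta S) - hat S Q)"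
    using openin_beta_hat[of "S - Q" S] hat_compl[OF Q] by (simp add: topspace_beta)
  then show ?thesis
    unfolding clopenin_def closedin_def using openin_beta_hat[OF Q] by (auto simp: topspace_beta hat_iff)
qed

text \<open>A nonempty open set contains some nonempty \<open>hat S Q\<close>. Then \<open>Q\<close>
  is nonempty, since no ultrafilter contains the empty set, and any point of \<open>Q\<close> serves
  as \<open>s\<close>.\<close>

lemma principal_dense:
  assumes "openin (beta S) U" "U \<noteq> {}"
  obtains s where "s \<in> S" "principal S s \<in> U"
proof -
  obtain \<alpha> Q where Q: "Q \<subseteq> S" "\<alpha> \<in> hat S Q" "hat S Q \<subseteq> U"
    using assms unfolding openin_beta_iff by blast
  then have "Q \<noteq> {}" by (auto simp: hat_iff dest: ultrafilterD(3))
  then obtain s where s: "s \<in> Q" by blast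
  then have "principal S s \<in> hat S Q"
    using Q(1) principal_ultrafilter[of s S] unfolding hat_iff by (auto simp: principal_def)
  then show ?thesis using that s Q by blast
qed

lemma principal_in_hat_iff: "s \<in> S \<Longrightarrow> Q \<subseteq> S \<Longrightarrow> principal S s \<in> hat S Q \<longleftrightarrow> s \<in> Q"
  using principal_ultrafilter[of s S] by (simp add: hat_iff) (simp add: principal_def)

text \<open>\<open>Q\<close> is the trace of \<open>K\<close> on the principal ultrafilters. Both
  differences of \<open>K\<close> and \<open>hat S Q\<close> are open and contain no principal
  ultrafilter, so density makes them empty.\<close>

lemma clopenin_beta_imp_hat:
  assumes "clopenin (beta S) K"
  obtains Q where "Q \<subseteq> S" "K = hat S Q"
proof -
  define Q where "Q = {s \<in> S. principal S s \<in> K}"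
  have Q: "Q \<subseteq> S" by (auto simp: Q_def)
  have "openin (beta S) (K - hat S Q)" "openin (beta S) (hat S Q - K)"
    using assms clopenin_hat[OF Q] unfolding clopenin_def by (auto intro: openin_diff)
  moreover have "principal S s \<notin> K - hat S Q" "principal S s \<notin> hat S Q - K" if "s \<in> S" for s
    using principal_in_hat_iff[OF that Q] that by (auto simp: Q_def)
  ultimately have "K - hat S Q = {}" "hat S Q - K = {}"
    using principal_dense by metis+
  then show ?thesis using that Q by blast
qed

lemma closedin_beta_separate:
  assumes "closedin (beta S) C" "\<alpha> \<in> ultrafilters S (Pow S)" "\<alpha> \<notin> C"
  obtains Q where "Q \<subseteq> S" "\<alpha> \<in> hat S Q" "C \<inter> hat S Q = {}"
proof -
  have "openin (beta S) (ultrafilters S (Pow S) - C)"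
    using assms(1) by (simp add: closedin_def topspace_beta)
  then obtain Q where "Q \<subseteq> S" "\<alpha> \<in> hat S Q" "hat S Q \<subseteq> ultrafilters S (Pow S) - C"
    using assms(2,3) unfolding openin_beta_iff by (metis DiffI)
  then show ?thesis by (intro that) auto
qed

text \<open>A point of one closed set outside the other has a basic neighbourhood that misses the
  other. This is why the ultrafilter \<open>u\<close> in \<open>X_space\<close> determines each
  coordinate \<open>C a\<close>.\<close>

lemma closedin_beta_eqI:
  assumes "closedin (beta S) C" "closedin (beta S) D"
    and "\<And>Q. Q \<subseteq> S \<Longrightarrow> C \<inter> hat S Q \<noteq> {} \<longleftrightarrow> D \<inter> hat S Q \<noteq> {}"
  shows "C = D"
proof -
  have "C' \<subseteq> D'" if "closedin (beta S) C'" "closedin (beta S) D'"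
    "\<And>Q. Q \<subseteq> S \<Longrightarrow> C' \<inter> hat S Q \<noteq> {} \<Longrightarrow> D' \<inter> hat S Q \<noteq> {}" for C' D'
  proof
    fix \<alpha> assume \<alpha>: "\<alpha> \<in> C'"
    then have "\<alpha> \<in> ultrafilters S (Pow S)"
      using closedin_subset[OF that(1)] topspace_beta by blast
    then show "\<alpha> \<in> D'" using closedin_beta_separate[OF that(2)] that(3) \<alpha> by (metis disjoint_iff)
  qed
  then show ?thesis using assms by (metis subset_antisym)
qed

section \<open>The Vietoris space\<close>

lemma topspace_vietoris: "topspace (vietoris X) = {C. closedin X C}"
proof -
  have "clopenin X (topspace X)" by (simp add: clopenin_def)
  moreover have "vietoris_box X (topspace X) = {C. closedin X C}"
    unfolding vietoris_box_def using closedin_subset by auto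
  ultimately have "{C. closedin X C} \<in> {vietoris_box X K |K. clopenin X K}" by blast
  then have "{C. closedin X C} \<subseteq> topspace (vietoris X)"
    unfolding vietoris_def topology_generated_by_topspace by blast
  then show ?thesis
    unfolding vietoris_def topology_generated_by_topspace
    by (auto simp: vietoris_box_def vietoris_diamond_def)
qed

lemma openin_vietoris:
  assumes "clopenin X K"
  shows "openin (vietoris X) (vietoris_box X K)" "openin (vietoris X) (vietoris_diamond X K)"
  unfolding vietoris_def using assms by (auto intro!: topology_generated_by_Basis)

text \<open>If \<open>\<alpha>\<close> lies in \<open>C\<close> but not in \<open>D\<close>, choose
  a \<open>hat S Q\<close> around \<open>\<alpha>\<close> that misses \<open>D\<close>. The diamond
  of \<open>hat S Q\<close> and the box of its complement then separate \<open>C\<close> from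
  \<open>D\<close>.\<close>

lemma Hausdorff_vietoris_beta: "Hausdorff_space (vietoris (beta S))"
proof -
  have sep: "\<exists>U V. openin (vietoris (beta S)) U \<and> openin (vietoris (beta S)) V \<and>
      C \<in> U \<and> D \<in> V \<and> disjnt U V"
    if CD: "closedin (beta S) C" "closedin (beta S) D" "\<alpha> \<in> C" "\<alpha> \<notin> D" for C D \<alpha>
  proof -
    have "\<alpha> \<in> ultrafilters S (Pow S)"
      using closedin_subset[OF CD(1)] CD(3) topspace_beta by blast
    then obtain Q where Q: "Q \<subseteq> S" "\<alpha> \<in> hat S Q" "D \<inter> hat S Q = {}"
      using closedin_beta_separate CD by metis
    have "D \<subseteq> hat S (S - Q)"
      using Q hat_compl[OF Q(1)] closedin_subset[OF CD(2)] topspace_beta by blast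
    moreover have "disjnt (hat S Q) (hat S (S - Q))"
      using hat_compl[OF Q(1)] by (auto simp: disjnt_def)
    ultimately have "C \<in> vietoris_diamond (beta S) (hat S Q)"
      "D \<in> vietoris_box (beta S) (hat S (S - Q))"
      "disjnt (vietoris_diamond (beta S) (hat S Q)) (vietoris_box (beta S) (hat S (S - Q)))"
      using Q CD unfolding vietoris_diamond_def vietoris_box_def disjnt_def by blast+
    then show ?thesis
      using openin_vietoris(2)[OF clopenin_hat[OF Q(1)]]
        openin_vietoris(1)[OF clopenin_hat[OF Diff_subset]] by blast
  qed
  show ?thesis
    unfolding Hausdorff_space_def topspace_vietoris
  proof (intro allI impI)
    fix C D
    assume CD: "C \<in> {C. closedin (beta S) C} \<and> D \<in> {C. closedin (beta S) C} \<and> C \<noteq> D"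
    then consider \<alpha> where "\<alpha> \<in> C" "\<alpha> \<notin> D" | \<alpha> where "\<alpha> \<in> D" "\<alpha> \<notin> C" by blast
    then show "\<exists>U V. openin (vietoris (beta S)) U \<and> openin (vietoris (beta S)) V \<and>
        C \<in> U \<and> D \<in> V \<and> disjnt U V"
    proof cases
      case 1
      then show ?thesis using sep CD by blast
    next
      case 2
      then show ?thesis using sep[of D C \<alpha>] CD disjnt_sym by blast
    qed
  qed
qed

text \<open>This gives uniqueness of the continuous extension. At a point of disagreement, the
  preimages of separating open sets intersect in a nonempty open set, which contains a principal
  ultrafilter where the maps agree.\<close>

lemma continuous_map_beta_eqI:
  assumes f: "continuous_map (beta S) Y f" and g: "continuous_map (beta S) Y g"
    and "Hausdorff_space Y"
    and eq: "\<And>s. s \<in> S \<Longrightarrow> f (principal S s) = g (principal S s)"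
    and x: "x \<in> topspace (beta S)"
  shows "f x = g x"
proof (rule ccontr)
  assume "f x \<noteq> g x"
  moreover have "f x \<in> topspace Y" "g x \<in> topspace Y"
    using f g x continuous_map_image_subset_topspace by blast+
  ultimately obtain U V where UV: "openin Y U" "openin Y V" "f x \<in> U" "g x \<in> V" "disjnt U V"
    using assms(3) unfolding Hausdorff_space_def by blast
  let ?W = "{y \<in> topspace (beta S). f y \<in> U} \<inter> {y \<in> topspace (beta S). g y \<in> V}"
  have "openin (beta S) ?W"
    using UV f g by (intro openin_Int openin_continuous_map_preimage)
  moreover have "?W \<noteq> {}" using x UV by blast
  ultimately obtain s where "s \<in> S" "principal S s \<in> ?W" by (rule principal_dense)
  then show False using eq UV(5) by (auto simp: disjnt_def)
qed

section \<open>The content map\<close>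

text \<open>An explicit candidate for the continuous extension. Restricting to
  \<open>tuples A k\<close> makes its values extensional, as points of
  \<open>product_topology\<close> must be.\<close>

definition content_ext ::
  "'a set \<Rightarrow> nat \<Rightarrow> 'a list set set \<Rightarrow> 'a list \<Rightarrow> nat list set set set" where
  "content_ext A k x = (\<lambda>a\<in>tuples A k.
     {\<alpha> \<in> ultrafilters (nat_tuples k) (Pow (nat_tuples k)). \<forall>Q\<in>\<alpha>. L_diamond A a Q \<in> x})"

lemma L_diamond_subset: "L_diamond A a Q \<subseteq> lists A"
  by (auto simp: L_diamond_def)

lemma L_diamond_Un: "L_diamond A a (P \<union> Q) = L_diamond A a P \<union> L_diamond A a Q"
  by (auto simp: L_diamond_def)

lemma L_diamond_empty: "L_diamond A a {} = {}"
  by (simp add: L_diamond_def)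

lemma content_ext_meets_iff:
  assumes x: "x \<in> ultrafilters (lists A) (Pow (lists A))"
    and a: "a \<in> tuples A k" and Q: "Q \<subseteq> nat_tuples k"
  shows "content_ext A k x a \<inter> hat (nat_tuples k) Q \<noteq> {} \<longleftrightarrow> L_diamond A a Q \<in> x"
proof
  assume "content_ext A k x a \<inter> hat (nat_tuples k) Q \<noteq> {}"
  then show "L_diamond A a Q \<in> x" using a by (auto simp: content_ext_def hat_iff)
next
  assume LQ: "L_diamond A a Q \<in> x"
  have L_Un: "L_diamond A a (P \<union> R) \<in> x \<longleftrightarrow> L_diamond A a P \<in> x \<or> L_diamond A a R \<in> x" for P R
    using ultrafilter_Un_iff[OF x] L_diamond_subset by (metis L_diamond_Un)
  \<comment> \<open>The filter generated by \<open>Q\<close> and the complements of the ideal \<open>{P. L_diamond A a P \<notin> x}\<close>.\<close>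
  define F where "F = {R. R \<subseteq> nat_tuples k \<and> L_diamond A a (Q - R) \<notin> x}"
  have "Q - nat_tuples k = {}" using Q by blast
  then have "L_diamond A a (Q - nat_tuples k) \<notin> x"
    using ultrafilterD(3)[OF x] L_diamond_empty by metis
  then have "nat_tuples k \<in> F" by (simp add: F_def)
  moreover have "{} \<notin> F" using LQ by (simp add: F_def)
  moreover have "P \<inter> R \<in> F" if "P \<in> F" "R \<in> F" for P R
    using that L_Un by (auto simp: F_def Diff_Int)
  moreover have "F \<subseteq> Pow (nat_tuples k)" by (auto simp: F_def)
  ultimately obtain \<alpha> where \<alpha>: "\<alpha> \<in> ultrafilters (nat_tuples k) (Pow (nat_tuples k))" "F \<subseteq> \<alpha>"
    using ultrafilter_extension[of F "nat_tuples k"] by blast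
  have "Q \<in> F"
    using Q ultrafilterD(3)[OF x] by (simp add: F_def L_diamond_empty)
  moreover have "L_diamond A a P \<in> x" if "P \<in> \<alpha>" for P
  proof (rule ccontr)
    assume "L_diamond A a P \<notin> x"
    moreover have P: "P \<subseteq> nat_tuples k" using ultrafilterD(1)[OF \<alpha>(1)] that by blast
    \<comment> \<open>As \<open>Q\<close> lies in \<open>nat_tuples k\<close>, the set
      \<open>Q - (nat_tuples k - P)\<close> is the intersection of \<open>Q\<close> and
      \<open>P\<close>, a part of \<open>P\<close>. Through \<open>L_Un\<close> the non-membership
      passes from \<open>P\<close> to this part, so the complement of \<open>P\<close> is in
      \<open>F\<close>.\<close>
    then have "P = (Q - (nat_tuples k - P)) \<union> P" using Q by blast
    ultimately have "L_diamond A a (Q - (nat_tuples k - P)) \<notin> x" using L_Un by metis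
    then have "nat_tuples k - P \<in> \<alpha>" using \<alpha>(2) by (auto simp: F_def)
    then show False using ultrafilter_Diff_iff[OF \<alpha>(1)] P that by blast
  qed
  ultimately have "\<alpha> \<in> content_ext A k x a \<inter> hat (nat_tuples k) Q"
    using a \<alpha> by (auto simp: content_ext_def hat_iff)
  then show "content_ext A k x a \<inter> hat (nat_tuples k) Q \<noteq> {}" by blast
qed

text \<open>A point outside the set has a member \<open>Q\<close> with
  \<open>L_diamond A a Q\<close> not in \<open>x\<close>. By \<open>content_ext_meets_iff\<close>,
  the whole neighbourhood \<open>hat Q\<close> then misses the set.\<close>

lemma closedin_content_ext:
  assumes "x \<in> ultrafilters (lists A) (Pow (lists A))" "a \<in> tuples A k"
  shows "closedin (beta (nat_tuples k)) (content_ext A k x a)"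
proof -
  let ?S = "nat_tuples k"
  let ?C = "ultrafilters ?S (Pow ?S) - content_ext A k x a"
  have "\<exists>Q\<subseteq>?S. \<alpha> \<in> hat ?S Q \<and> hat ?S Q \<subseteq> ?C" if "\<alpha> \<in> ?C" for \<alpha>
  proof -
    obtain Q where Q: "Q \<in> \<alpha>" "L_diamond A a Q \<notin> x"
      using \<open>\<alpha> \<in> ?C\<close> assms(2) by (auto simp: content_ext_def)
    have "Q \<subseteq> ?S" using \<open>\<alpha> \<in> ?C\<close> Q(1) ultrafilterD(1) by blast
    then have "content_ext A k x a \<inter> hat ?S Q = {}"
      using Q(2) content_ext_meets_iff[OF assms] by blast
    then have "hat ?S Q \<subseteq> ?C" by (auto simp: hat_iff)
    then show ?thesis
      using Q(1) \<open>\<alpha> \<in> ?C\<close> \<open>Q \<subseteq> ?S\<close> by (intro exI[of _ Q]) (simp add: hat_iff)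
  qed
  then have "openin (beta ?S) ?C"
    by (auto simp: openin_beta_iff)
  moreover have "content_ext A k x a \<subseteq> ultrafilters ?S (Pow ?S)"
    using assms(2) by (auto simp: content_ext_def)
  ultimately show ?thesis by (simp add: closedin_def topspace_beta)
qed

lemma content_ext_principal:
  assumes w: "w \<in> lists A"
  shows "content_ext A k (principal (lists A) w) = word_contents A k w"
proof -
  let ?S = "nat_tuples k"
  have "{\<alpha> \<in> ultrafilters ?S (Pow ?S). \<forall>Q\<in>\<alpha>. L_diamond A a Q \<in> principal (lists A) w}
      = hat ?S (content a w)" if a: "a \<in> tuples A k" for a
  proof -
    have c: "content a w \<subseteq> ?S" using a by (auto simp: content_def tuples_def)
    have "L_diamond A a Q \<in> principal (lists A) w \<longleftrightarrow> content a w \<inter> Q \<noteq> {}" for Q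
      using w by (auto simp: principal_def L_diamond_def)
    \<comment> \<open>An ultrafilter all of whose members meet the content must contain it, since
      otherwise the complement of the content would be a member.\<close>
    moreover have "(\<forall>Q\<in>\<alpha>. content a w \<inter> Q \<noteq> {}) \<longleftrightarrow> content a w \<in> \<alpha>"
      if \<alpha>: "\<alpha> \<in> ultrafilters ?S (Pow ?S)" for \<alpha>
    proof
      assume "\<forall>Q\<in>\<alpha>. content a w \<inter> Q \<noteq> {}"
      then have "?S - content a w \<notin> \<alpha>" by blast
      then show "content a w \<in> \<alpha>" using ultrafilter_Diff_iff[OF \<alpha>] c by blast
    next
      assume "content a w \<in> \<alpha>"
      then show "\<forall>Q\<in>\<alpha>. content a w \<inter> Q \<noteq> {}" using ultrafilterD(3,4)[OF \<alpha>] by metis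
    qed
    ultimately show ?thesis unfolding hat_def by (intro Collect_cong) metis
  qed
  then show ?thesis unfolding content_ext_def word_contents_def by (simp cong: restrict_cong)
qed

text \<open>Continuity is checked in each coordinate on the Vietoris subbase. As every clopen is a
  hat, the preimages are those computed in \<open>dia\<close> and \<open>box\<close>, both of them
  hats of languages.\<close>

lemma continuous_content_ext:
  "continuous_map (beta (lists A)) (V_space A k) (content_ext A k)"
proof -
  let ?S = "nat_tuples k" and ?X = "beta (lists A)"
  have "continuous_map ?X (vietoris (beta ?S)) (\<lambda>x. content_ext A k x a)"
    if a: "a \<in> tuples A k" for a
  proof -
    have dia: "{x \<in> topspace ?X. content_ext A k x a \<in> vietoris_diamond (beta ?S) (hat ?S Q)}
        = hat (lists A) (L_diamond A a Q)" if "Q \<subseteq> ?S" for Q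
      using content_ext_meets_iff[OF _ a that] closedin_content_ext[OF _ a]
      unfolding topspace_beta vietoris_diamond_def hat_def[of "lists A"] mem_Collect_eq
      by (intro Collect_cong) blast
    \<comment> \<open>Box is dual to diamond: a closed set lies in \<open>hat ?S Q\<close> exactly
      when it misses the hat of the complement of \<open>Q\<close>.\<close>
    have box: "{x \<in> topspace ?X. content_ext A k x a \<in> vietoris_box (beta ?S) (hat ?S Q)}
        = hat (lists A) (lists A - L_diamond A a (?S - Q))" if Q: "Q \<subseteq> ?S" for Q
    proof -
      have "content_ext A k x a \<subseteq> hat ?S Q \<longleftrightarrow> L_diamond A a (?S - Q) \<notin> x"
        if x: "x \<in> ultrafilters (lists A) (Pow (lists A))" for x
      proof -
        have "content_ext A k x a \<subseteq> ultrafilters ?S (Pow ?S)"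
          using a by (auto simp: content_ext_def)
        then have "content_ext A k x a \<subseteq> hat ?S Q \<longleftrightarrow>
            content_ext A k x a \<inter> hat ?S (?S - Q) = {}"
          unfolding hat_compl[OF Q] by blast
        then show ?thesis using content_ext_meets_iff[OF x a, of "?S - Q"] by blast
      qed
      then show ?thesis
        using closedin_content_ext[OF _ a]
        unfolding topspace_beta vietoris_box_def hat_compl[OF L_diamond_subset]
          mem_Collect_eq
        by (intro set_eqI) (unfold Diff_iff mem_Collect_eq hat_iff[of _ "lists A"], blast)
    qed
    show ?thesis
      unfolding vietoris_def
    proof (rule continuous_on_generated_topo)
      fix U assume "U \<in> {vietoris_box (beta ?S) K |K. clopenin (beta ?S) K} \<union>
          {vietoris_diamond (beta ?S) K |K. clopenin (beta ?S) K}"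
      then obtain Q where Q: "Q \<subseteq> ?S"
        and U: "U = vietoris_box (beta ?S) (hat ?S Q) \<or> U = vietoris_diamond (beta ?S) (hat ?S Q)"
        by (auto elim!: clopenin_beta_imp_hat)
      have "(\<lambda>x. content_ext A k x a) -` U \<inter> topspace ?X
          = {x \<in> topspace ?X. content_ext A k x a \<in> U}" by auto
      then show "openin ?X ((\<lambda>x. content_ext A k x a) -` U \<inter> topspace ?X)"
        using U dia[OF Q] box[OF Q] openin_beta_hat[OF L_diamond_subset] openin_beta_hat[OF Diff_subset]
        by (elim disjE) simp_all
    next
      show "(\<lambda>x. content_ext A k x a) ` topspace ?X \<subseteq>
        \<Union> ({vietoris_box (beta ?S) K |K. clopenin (beta ?S) K} \<union>
          {vietoris_diamond (beta ?S) K |K. clopenin (beta ?S) K})"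
        using closedin_content_ext[OF _ a] topspace_vietoris[of "beta ?S"]
        unfolding vietoris_def topology_generated_by_topspace topspace_beta by auto
    qed
  qed
  then show ?thesis
    unfolding V_space_def continuous_map_componentwise by (auto simp: content_ext_def)
qed

text \<open>Existence in the definite description is the continuity of \<open>content_ext\<close>
  with its values at words; uniqueness is agreement on a dense set with Hausdorff codomain. The
  restriction meets the extensionality clause.\<close>

lemma content_map_eq: "content_map A k = restrict (content_ext A k) (topspace (beta (lists A)))"
  unfolding content_map_def
proof (rule the_equality)
  let ?X = "beta (lists A)"
  have p: "principal (lists A) w \<in> topspace ?X" if "w \<in> lists A" for w
    using principal_ultrafilter[OF that] by (simp add: topspace_beta)
  have cont: "continuous_map ?X (V_space A k) (restrict (content_ext A k) (topspace ?X))"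
    using continuous_content_ext by (rule continuous_map_eq) simp
  then show "restrict (content_ext A k) (topspace ?X) \<in> extensional (topspace ?X) \<and>
      continuous_map ?X (V_space A k) (restrict (content_ext A k) (topspace ?X)) \<and>
      (\<forall>w\<in>lists A. restrict (content_ext A k) (topspace ?X) (principal (lists A) w) =
        word_contents A k w)"
    using p content_ext_principal by (intro conjI ballI restrict_extensional) simp_all
  fix c
  assume c: "c \<in> extensional (topspace ?X) \<and> continuous_map ?X (V_space A k) c \<and>
    (\<forall>w\<in>lists A. c (principal (lists A) w) = word_contents A k w)"
  have haus: "Hausdorff_space (V_space A k)"
    unfolding V_space_def Hausdorff_space_product_topology using Hausdorff_vietoris_beta by blast
  have "c x = restrict (content_ext A k) (topspace ?X) x" if "x \<in> topspace ?X" for x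
  proof (rule continuous_map_beta_eqI[where f = c, OF _ cont haus _ that])
    show "continuous_map ?X (V_space A k) c" using c by blast
    show "c (principal (lists A) w) = restrict (content_ext A k) (topspace ?X) (principal (lists A) w)"
      if "w \<in> lists A" for w
      using c p[OF that] content_ext_principal[OF that] that by simp
  qed
  then show "c = restrict (content_ext A k) (topspace ?X)"
    using c by (intro extensionalityI[of _ "topspace ?X"]) simp_all
qed

section \<open>The algebra of languages and the image of the content map\<close>

lemma algebra_B_alg: "algebra (lists A) (B_alg A k)"
proof -
  let ?G = "{L_diamond A a Q |a Q. a \<in> tuples A k \<and> Q \<subseteq> nat_tuples k}"
  have "algebra (lists A) (Pow (lists A))" by (rule algebra_Pow)
  moreover have "?G \<subseteq> Pow (lists A)" using L_diamond_subset by blast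
  ultimately have "B_alg A k \<subseteq> Pow (lists A)"
    unfolding B_alg_def by (intro hull_minimal)
  \<comment> \<open>A hull is just the intersection of all algebras containing the generators.
    Spelled out in this way, each closure property is inherited from these algebras.\<close>
  moreover have B: "L \<in> B_alg A k \<longleftrightarrow> (\<forall>T. algebra (lists A) T \<and> ?G \<subseteq> T \<longrightarrow> L \<in> T)" for L
    unfolding B_alg_def hull_def by blast
  moreover have "{} \<in> T" "L \<in> T \<Longrightarrow> lists A - L \<in> T" "L \<in> T \<Longrightarrow> M \<in> T \<Longrightarrow> L \<union> M \<in> T"
    if "algebra (lists A) T" for T L M
    using that unfolding algebra_iff_Un by auto
  ultimately show ?thesis
    unfolding algebra_iff_Un[of _ "B_alg A k"] by (intro conjI ballI) (simp_all add: B)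
qed

lemma L_diamond_in_B_alg:
  "a \<in> tuples A k \<Longrightarrow> Q \<subseteq> nat_tuples k \<Longrightarrow> L_diamond A a Q \<in> B_alg A k"
  unfolding B_alg_def by (rule hull_inc) blast

theorem mainTheorem1:
  fixes A :: "'a set" and k :: nat
  assumes "finite A" and "k \<ge> 1"
  shows "content_map A k ` topspace (beta (lists A)) = X_space A k"
proof -
  let ?S = "nat_tuples k" and ?B = "B_alg A k" and ?U = "ultrafilters (lists A) (Pow (lists A))"
  have B: "?B \<subseteq> Pow (lists A)"
    using algebra_B_alg[of A k] by (simp add: algebra_iff_Un)
  have "content_ext A k ` ?U = X_space A k"
  proof (intro equalityI subsetI)
    fix C assume "C \<in> content_ext A k ` ?U"
    then obtain x where x: "x \<in> ?U" "C = content_ext A k x" by blast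
    have "C \<in> topspace (V_space A k)"
      using continuous_map_image_subset_topspace[OF continuous_content_ext] x
      by (auto simp: topspace_beta)
    \<comment> \<open>The witness for membership in \<open>X_space\<close> is the trace of
      \<open>x\<close>; the languages to be tested all lie in \<open>?B\<close>, so the trace
      decides them as \<open>x\<close> does.\<close>
    moreover have "x \<inter> ?B \<in> ultrafilters (lists A) ?B"
      using ultrafilter_restrict[OF x(1) algebra_B_alg] .
    moreover have "C a \<inter> hat ?S Q \<noteq> {} \<longleftrightarrow> L_diamond A a Q \<in> x \<inter> ?B"
      if "a \<in> tuples A k" "Q \<subseteq> ?S" for a Q
      using content_ext_meets_iff[OF x(1) that] L_diamond_in_B_alg[OF that] x(2) by blast
    ultimately show "C \<in> X_space A k" unfolding X_space_def by blast
  next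
    fix C assume "C \<in> X_space A k"
    then obtain u where C: "C \<in> topspace (V_space A k)" and u: "u \<in> ultrafilters (lists A) ?B"
      and Cu: "\<And>a Q. a \<in> tuples A k \<Longrightarrow> Q \<subseteq> ?S \<Longrightarrow>
        C a \<inter> hat ?S Q \<noteq> {} \<longleftrightarrow> L_diamond A a Q \<in> u"
      unfolding X_space_def by blast
    \<comment> \<open>Conversely, any extension \<open>x\<close> of \<open>u\<close> is a preimage
      of \<open>C\<close>: \<open>content_ext A k x a\<close> and \<open>C a\<close> are closed and
      meet the same hats, both governed by \<open>u\<close>.\<close>
    obtain x where x: "x \<in> ?U" "x \<inter> ?B = u"
      using ultrafilter_subalgebra_extension[OF u B] .
    have "C a = content_ext A k x a" if a: "a \<in> tuples A k" for a
    proof (rule closedin_beta_eqI)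
      show "closedin (beta ?S) (C a)"
        using C a by (auto simp: V_space_def topspace_vietoris)
      show "closedin (beta ?S) (content_ext A k x a)"
        using closedin_content_ext[OF x(1) a] .
      show "C a \<inter> hat ?S Q \<noteq> {} \<longleftrightarrow> content_ext A k x a \<inter> hat ?S Q \<noteq> {}" if "Q \<subseteq> ?S" for Q
        using Cu[OF a that] content_ext_meets_iff[OF x(1) a that] L_diamond_in_B_alg[OF a that] x(2)
        by blast
    qed
    moreover have "C \<in> extensional (tuples A k)" using C by (auto simp: V_space_def PiE_def)
    moreover have "content_ext A k x \<in> extensional (tuples A k)" by (simp add: content_ext_def)
    ultimately have "C = content_ext A k x" by (intro extensionalityI) auto
    then show "C \<in> content_ext A k ` ?U" using x(1) by blast
  qed
  then show ?thesis unfolding content_map_eq by (simp add: topspace_beta)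
qed

end
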